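(* Let $A\subset\mathbb{R}$ be an open invex subset with respect to $\eta:A\times A\to\mathbb{R}$ and let $a,b\in A$ with $a<a+\eta(b,a)$. Suppose that $f:A\to\mathbb{R}$ is a differentiable function and that $|f'|$ is preinvex on $A$ with respect to $\eta$. If $f'$ is integrable on $[a,a+\eta(b,a)]$, then for all $x\in[a,a+\eta(b,a)]$ $$\left|f(x)-\frac{1}{\eta(b,a)}\int_{a}^{a+\eta(b,a)}f(u)\,du\right|\le\frac{\eta(b,a)}{6}\left\{\left[3\left(\frac{x-a}{\eta(b,a)}\right)^{2}-2\left(\frac{x-a}{\eta(b,a)}\right)^{3}+2\left(\frac{a+\eta(b,a)-x}{\eta(b,a)}\right)^{3}\right]|f'(a)|+\left[1-3\left(\frac{x-a}{\eta(b,a)}\right)^{2}+4\left(\frac{x-a}{\eta(b,a)}\right)^{3}\right]|f'(b)|\right\}.$$ The constant $\frac16$ is best possible in the sense that it cannot be replaced by a smaller value: if $K>0$ is a constant such that the inequality with $\frac16$ replaced by $K$ holds for all such $f$ and all $x\in[a,a+\eta(b,a)]$, then $K\ge\frac16$.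
   Context: A set $A\subset\mathbb{R}$ is called invex with respect to $\eta:A\times A\to\mathbb{R}$ if $x+t\eta(y,x)\in A$ for all $x,y\in A$ and $t\in[0,1]$. A function $g:A\to\mathbb{R}$ on an invex set $A$ is called preinvex with respect to $\eta$ if $g(x+t\eta(y,x))\le(1-t)g(x)+t\,g(y)$ for all $x,y\in A$ and $t\in[0,1]$. *)

theory Defs
  imports "HOL-Analysis.Analysis"
begin

definition invex :: "real set \<Rightarrow> (real \<Rightarrow> real \<Rightarrow> real) \<Rightarrow> bool" where
  "invex A \<eta> \<longleftrightarrow> (\<forall>x\<in>A. \<forall>y\<in>A. \<forall>t\<in>{0..1}. x + t * \<eta> y x \<in> A)"

definition preinvex_on :: "real set \<Rightarrow> (real \<Rightarrow> real \<Rightarrow> real) \<Rightarrow> (real \<Rightarrow> real) \<Rightarrow> bool" where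
  "preinvex_on A \<eta> g \<longleftrightarrow> invex A \<eta> \<and>
     (\<forall>x\<in>A. \<forall>y\<in>A. \<forall>t\<in>{0..1}. g (x + t * \<eta> y x) \<le> (1 - t) * g x + t * g y)"

end

theory Submission
  imports Defs
begin

text \<open>Preinvexity bounds the derivative of \<open>f\<close> on the interval by an affine function, so by
  monotonicity the increments of \<open>f\<close> are bounded by those of a quadratic primitive \<open>P\<close> of that affine
  function. Averaging \<open>\<bar>f x - f u\<bar> \<le> \<bar>P x - P u\<bar>\<close> over \<open>u\<close> gives exactly the stated cubic, without
  any integration by parts. The identity function at \<open>x = a\<close> yields equality.\<close>

text \<open>The bound \<open>\<bar>f' u\<bar> \<le> P' u\<close> says that \<open>P - f\<close> and
  \<open>P + f\<close> both have nonnegative derivative. Both are therefore nondecreasing, which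
  gives the two one-sided estimates.\<close>

lemma abs_increment_le_of_abs_deriv_le:
  fixes f P :: "real \<Rightarrow> real"
  assumes f: "\<And>u. u \<in> {a..c} \<Longrightarrow> (f has_real_derivative f' u) (at u)"
    and P: "\<And>u. u \<in> {a..c} \<Longrightarrow> (P has_real_derivative P' u) (at u)"
    and le: "\<And>u. u \<in> {a..c} \<Longrightarrow> \<bar>f' u\<bar> \<le> P' u"
    and uv: "a \<le> u" "u \<le> v" "v \<le> c"
  shows "\<bar>f v - f u\<bar> \<le> P v - P u"
proof -
  have "(\<lambda>y. P y - f y) u \<le> (\<lambda>y. P y - f y) v"
  proof (rule DERIV_nonneg_imp_nondecreasing[OF uv(2)])
    fix y assume "u \<le> y" "y \<le> v"
    then have y: "y \<in> {a..c}" using uv by auto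
    show "\<exists>d. ((\<lambda>y. P y - f y) has_real_derivative d) (at y) \<and> 0 \<le> d"
      using DERIV_diff[OF P[OF y] f[OF y]] le[OF y] by (intro exI[of _ "P' y - f' y"]) auto
  qed
  moreover have "(\<lambda>y. P y + f y) u \<le> (\<lambda>y. P y + f y) v"
  proof (rule DERIV_nonneg_imp_nondecreasing[OF uv(2)])
    fix y assume "u \<le> y" "y \<le> v"
    then have y: "y \<in> {a..c}" using uv by auto
    show "\<exists>d. ((\<lambda>y. P y + f y) has_real_derivative d) (at y) \<and> 0 \<le> d"
      using DERIV_add[OF P[OF y] f[OF y]] le[OF y] by (intro exI[of _ "P' y + f' y"]) auto
  qed
  ultimately show ?thesis by auto
qed

text \<open>Monotonicity makes the sign of \<open>P x - P u\<close> change only at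
  \<open>u = x\<close>. Splitting there removes the absolute value, and on each side
  \<open>u * P x - Q u\<close>, up to sign, is a primitive.\<close>

lemma has_integral_abs_increment:
  fixes P Q :: "real \<Rightarrow> real"
  assumes Q: "\<And>u. u \<in> {a..c} \<Longrightarrow> (Q has_real_derivative P u) (at u)"
    and mono: "\<And>u v. a \<le> u \<Longrightarrow> u \<le> v \<Longrightarrow> v \<le> c \<Longrightarrow> P u \<le> P v"
    and x: "x \<in> {a..c}"
  shows "((\<lambda>u. \<bar>P x - P u\<bar>) has_integral (Q a + Q c - 2 * Q x + (2 * x - a - c) * P x)) {a..c}"
proof -
  have left: "((\<lambda>u. P x - P u) has_integral ((x * P x - Q x) - (a * P x - Q a))) {a..x}"
    using x by (intro fundamental_theorem_of_calculus)
      (auto intro!: derivative_eq_intros Q[THEN DERIV_subset]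
        simp flip: has_real_derivative_iff_has_vector_derivative)
  have right: "((\<lambda>u. P u - P x) has_integral ((Q c - c * P x) - (Q x - x * P x))) {x..c}"
    using x by (intro fundamental_theorem_of_calculus)
      (auto intro!: derivative_eq_intros Q[THEN DERIV_subset]
        simp flip: has_real_derivative_iff_has_vector_derivative)
  have "((\<lambda>u. \<bar>P x - P u\<bar>) has_integral
      ((x * P x - Q x) - (a * P x - Q a)) + ((Q c - c * P x) - (Q x - x * P x))) {a..c}"
  proof (rule has_integral_combine)
    show "((\<lambda>u. \<bar>P x - P u\<bar>) has_integral ((x * P x - Q x) - (a * P x - Q a))) {a..x}"
      by (rule has_integral_eq[OF _ left]) (use mono x in auto)
    show "((\<lambda>u. \<bar>P x - P u\<bar>) has_integral ((Q c - c * P x) - (Q x - x * P x))) {x..c}"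
      by (rule has_integral_eq[OF _ right]) (use mono x in \<open>auto simp: abs_minus_commute[of "P x"]\<close>)
  qed (use x in auto)
  then show ?thesis by (simp add: algebra_simps)
qed

text \<open>Since the interval has length \<open>h\<close>, \<open>h\<close> times the deviation of
  \<open>f x\<close> from the mean is the integral of \<open>f x - f u\<close> over
  \<open>u\<close>, so a pointwise majorant can be integrated.\<close>

lemma abs_diff_mean_le:
  fixes f D :: "real \<Rightarrow> real"
  assumes h: "0 < h"
    and f: "continuous_on {a..a + h} f"
    and D: "(D has_integral I) {a..a + h}"
    and le: "\<And>u. u \<in> {a..a + h} \<Longrightarrow> \<bar>f x - f u\<bar> \<le> D u"
  shows "\<bar>f x - (1 / h) * (LBINT u:{a..a + h}. f u)\<bar> \<le> I / h"
proof -
  \<comment> \<open>Continuity on a compact interval lets the Lebesgue integral be replaced by the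
    gauge integral, for which the comparison is carried out.\<close>
  have "set_integrable lborel {a..a + h} f"
    using f by (intro borel_integrable_atLeastAtMost') auto
  then have L: "(LBINT u:{a..a + h}. f u) = integral {a..a + h} f"
    by (rule set_borel_integral_eq_integral)
  have int: "f integrable_on {a..a + h}"
    using f by (rule integrable_continuous_real)
  have const: "((\<lambda>u. f x) has_integral h * f x) {a..a + h}"
    using has_integral_const_real[of "f x" a "a + h"] h by simp
  have diff: "((\<lambda>u. f x - f u) has_integral h * f x - integral {a..a + h} f) {a..a + h}"
    by (rule has_integral_diff[OF const integrable_integral[OF int]])
  have "\<bar>h * f x - integral {a..a + h} f\<bar> \<le> I"
  proof (rule abs_leI)
    show "h * f x - integral {a..a + h} f \<le> I"
      by (rule has_integral_le[OF diff D]) (use le in \<open>auto simp: abs_le_iff\<close>)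
    show "- (h * f x - integral {a..a + h} f) \<le> I"
      by (rule has_integral_le[OF has_integral_neg[OF diff] D]) (use le in \<open>auto simp: abs_le_iff\<close>)
  qed
  moreover have "f x - (1 / h) * (LBINT u:{a..a + h}. f u) = (h * f x - integral {a..a + h} f) / h"
    using h by (simp add: L field_simps)
  ultimately show ?thesis
    using h by (simp add: abs_divide divide_right_mono)
qed

text \<open>This is the analytic core, free of \<open>\<eta>\<close>: all that remains of
  preinvexity is an affine majorant of \<open>\<bar>f'\<bar>\<close> running from \<alpha> at
  \<open>a\<close> to \<beta> at \<open>a + h\<close>.\<close>

lemma ostrowski_affine_bound:
  fixes f f' :: "real \<Rightarrow> real"
  assumes h: "0 < h"
    and f: "\<And>u. u \<in> {a..a + h} \<Longrightarrow> (f has_real_derivative f' u) (at u)"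
    and le: "\<And>t. t \<in> {0..1} \<Longrightarrow> \<bar>f' (a + t * h)\<bar> \<le> (1 - t) * \<alpha> + t * \<beta>"
    and x: "x \<in> {a..a + h}"
  shows "\<bar>f x - (1 / h) * (LBINT u:{a..a + h}. f u)\<bar> \<le> (h * (1 / 6)) *
     ((3 * ((x - a) / h)^2 - 2 * ((x - a) / h)^3 + 2 * ((a + h - x) / h)^3) * \<alpha>
        + (1 - 3 * ((x - a) / h)^2 + 4 * ((x - a) / h)^3) * \<beta>)"
proof -
  \<comment> \<open>\<open>T\<close> rescales the interval to \<open>{0..1}\<close>.
    \<open>P\<close> is the primitive of the affine majorant and \<open>Q\<close> the primitive of
    \<open>P\<close>, both vanishing at \<open>a\<close>; the factors \<open>h\<close> and
    \<open>h^2\<close> cancel the \<open>1 / h\<close> that each differentiation of \<open>T\<close>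
    produces.\<close>
  define T where "T u = (u - a) / h" for u
  define P where "P u = h * ((T u - (T u)^2 / 2) * \<alpha> + (T u)^2 / 2 * \<beta>)" for u
  define Q where "Q u = h^2 * (((T u)^2 / 2 - (T u)^3 / 6) * \<alpha> + (T u)^3 / 6 * \<beta>)" for u
  have T: "(T has_real_derivative 1 / h) (at u)" for u
    unfolding T_def using h by (auto intro!: derivative_eq_intros)
  have P: "(P has_real_derivative (1 - T u) * \<alpha> + T u * \<beta>) (at u)" for u
    unfolding P_def using h
    by (auto intro!: derivative_eq_intros T simp: field_simps)
  have Q: "(Q has_real_derivative P u) (at u)" for u
    unfolding Q_def P_def using h
    by (auto intro!: derivative_eq_intros T simp: field_simps power2_eq_square)
  have bound: "\<bar>f' u\<bar> \<le> (1 - T u) * \<alpha> + T u * \<beta>" if "u \<in> {a..a + h}" for u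
    using le[of "T u"] that h by (simp add: T_def)
  have incr: "\<bar>f v - f u\<bar> \<le> P v - P u" if "a \<le> u" "u \<le> v" "v \<le> a + h" for u v
    using abs_increment_le_of_abs_deriv_le[OF f P bound that] .
  have D: "((\<lambda>u. \<bar>P x - P u\<bar>) has_integral
      (Q a + Q (a + h) - 2 * Q x + (2 * x - a - (a + h)) * P x)) {a..a + h}"
  proof (rule has_integral_abs_increment[OF Q _ x])
    show "P u \<le> P v" if "a \<le> u" "u \<le> v" "v \<le> a + h" for u v
      \<comment> \<open>Monotonicity of \<open>P\<close> needs no sign condition on \<alpha> or
        \<beta>: its increments dominate an absolute value.\<close>
      using incr[OF that] by linarith
  qed
  have close: "\<bar>f x - f u\<bar> \<le> \<bar>P x - P u\<bar>" if "u \<in> {a..a + h}" for u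
    using incr[of u x] incr[of x u] that x by (cases "u \<le> x") auto
  have cont: "continuous_on {a..a + h} f"
    by (intro continuous_at_imp_continuous_on ballI) (rule DERIV_isCont[OF f])
  define s where "s = (x - a) / h"
  have width: "2 * x - a - (a + h) = h * (2 * s - 1)" using h by (simp add: s_def field_simps)
  have [simp]: "T a = 0" "T (a + h) = 1" "T x = s" and s': "(a + h - x) / h = 1 - s"
    using h by (simp_all add: T_def s_def field_simps)
  \<comment> \<open>In the coordinate \<open>s\<close> this is a polynomial identity: the
    coefficient of \<alpha> is \<open>2 - 6 * s + 9 * s^2 - 4 * s^3\<close> on both sides.\<close>
  have "(Q a + Q (a + h) - 2 * Q x + (2 * x - a - (a + h)) * P x) / h = (h * (1 / 6)) *
     ((3 * s^2 - 2 * s^3 + 2 * (1 - s)^3) * \<alpha> + (1 - 3 * s^2 + 4 * s^3) * \<beta>)"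
    unfolding Q_def P_def width using h
    by (simp add: field_simps power2_eq_square power3_eq_cube)
  with abs_diff_mean_le[OF h cont D close] show ?thesis
    unfolding s_def[symmetric] s' by (rule ord_le_eq_trans)
qed

theorem theorem2p2:
  fixes A :: "real set" and \<eta> :: "real \<Rightarrow> real \<Rightarrow> real" and a b :: real
  assumes "open A" and "invex A \<eta>" and "a \<in> A" and "b \<in> A" and "a < a + \<eta> b a"
  shows
    "(\<forall>f :: real \<Rightarrow> real.
        f differentiable_on A \<and> preinvex_on A \<eta> (\<lambda>u. \<bar>deriv f u\<bar>) \<and>
        set_integrable lborel {a..a + \<eta> b a} (deriv f) \<longrightarrow>
        (\<forall>x\<in>{a..a + \<eta> b a}.
           \<bar>f x - (1 / \<eta> b a) * (LBINT u:{a..a + \<eta> b a}. f u)\<bar> \<le>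
           (\<eta> b a * (1 / 6)) *
             ((3 * ((x - a) / \<eta> b a)^2 - 2 * ((x - a) / \<eta> b a)^3
                 + 2 * ((a + \<eta> b a - x) / \<eta> b a)^3) * \<bar>deriv f a\<bar>
              + (1 - 3 * ((x - a) / \<eta> b a)^2 + 4 * ((x - a) / \<eta> b a)^3) * \<bar>deriv f b\<bar>)))
     \<and>
     (\<forall>K > 0.
        (\<forall>f :: real \<Rightarrow> real.
          f differentiable_on A \<and> preinvex_on A \<eta> (\<lambda>u. \<bar>deriv f u\<bar>) \<and>
          set_integrable lborel {a..a + \<eta> b a} (deriv f) \<longrightarrow>
          (\<forall>x\<in>{a..a + \<eta> b a}.
             \<bar>f x - (1 / \<eta> b a) * (LBINT u:{a..a + \<eta> b a}. f u)\<bar> \<le>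
             (\<eta> b a * K) *
               ((3 * ((x - a) / \<eta> b a)^2 - 2 * ((x - a) / \<eta> b a)^3
                   + 2 * ((a + \<eta> b a - x) / \<eta> b a)^3) * \<bar>deriv f a\<bar>
                + (1 - 3 * ((x - a) / \<eta> b a)^2 + 4 * ((x - a) / \<eta> b a)^3) * \<bar>deriv f b\<bar>)))
        \<longrightarrow> K \<ge> 1 / 6)"
proof -
  define h where "h = \<eta> b a"
  have h: "0 < h" using assms(5) by (simp add: h_def)
  have sub: "{a..a + h} \<subseteq> A"
  proof
    fix u assume u: "u \<in> {a..a + h}"
    \<comment> \<open>Every point of the interval is \<open>a + t * h\<close> with
      \<open>t = (u - a) / h\<close>, so it lies on the invex path from \<open>a\<close> towards
      \<open>b\<close>.\<close>
    have "a + (u - a) / h * \<eta> b a \<in> A"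
      using assms(2)[unfolded invex_def, rule_format, OF assms(3,4), of "(u - a) / h"] u h by simp
    then show "u \<in> A" using h by (simp add: h_def)
  qed
  show ?thesis
    unfolding h_def[symmetric]
  proof (intro conjI allI impI ballI, goal_cases)
    case (1 f x)
    \<comment> \<open>Openness of \<open>A\<close> turns differentiability on \<open>A\<close> into
      two-sided differentiability, also at the endpoints \<open>a\<close> and
      \<open>a + h\<close>.\<close>
    have f: "(f has_real_derivative deriv f u) (at u)" if "u \<in> {a..a + h}" for u
      using 1 that sub assms(1)
      by (meson DERIV_deriv_iff_real_differentiable differentiable_on_eq_differentiable_at subset_eq)
    \<comment> \<open>The path ends at \<open>a + h\<close>, which may differ from \<open>b\<close>;
      preinvexity still bounds the value there by \<open>\<bar>deriv f b\<bar>\<close>.\<close>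
    have "\<bar>deriv f (a + t * h)\<bar> \<le> (1 - t) * \<bar>deriv f a\<bar> + t * \<bar>deriv f b\<bar>" if "t \<in> {0..1}" for t
      using 1 that assms(3,4) unfolding preinvex_on_def h_def by blast
    from ostrowski_affine_bound[OF h f this 1(2)] show ?case .
  next
    case (2 K)
    have id: "deriv (\<lambda>u::real. u) = (\<lambda>u. 1)"
      by (rule ext) simp
    have "set_integrable lborel {a..a + h} (\<lambda>u. 1 :: real)"
      by (intro borel_integrable_atLeastAtMost') auto
    \<comment> \<open>A constant satisfies the preinvexity inequality with equality, so the identity
      function is admissible whatever \<open>\<eta>\<close> is, given that \<open>A\<close> is
      invex.\<close>
    moreover have "preinvex_on A \<eta> (\<lambda>u. \<bar>1\<bar>)"
      using assms(2) by (simp add: preinvex_on_def)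
    moreover have "a \<in> {a..a + h}" using h by simp
    \<comment> \<open>At \<open>x = a\<close> the two weights are 2 and 1, whence the factor 3. The
      left side will turn out to be \<open>h / 2\<close>, so
      \<open>h / 2 \<le> 3 * h * K\<close>.\<close>
    ultimately have ineq: "\<bar>a - (1 / h) * (LBINT u:{a..a + h}. u)\<bar> \<le> (h * K) * 3"
      using 2(2)[rule_format, of "\<lambda>u. u" a] h unfolding id by simp
    have "set_integrable lborel {a..a + h} (\<lambda>u. u)"
      by (intro borel_integrable_atLeastAtMost') auto
    then have "(LBINT u:{a..a + h}. u) = integral {a..a + h} (\<lambda>u. u)"
      by (rule set_borel_integral_eq_integral)
    also have "\<dots> = ((a + h)^2 - a^2) / 2"
      using h by (intro integral_unique ident_has_integral) auto
    finally have "a - (1 / h) * (LBINT u:{a..a + h}. u) = - (h / 2)"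
      using h by (simp add: field_simps power2_eq_square)
    with ineq h have "h * (1 / 6) \<le> h * K" by simp
    then show ?case using h by (simp only: mult_le_cancel_left_pos)
  qed
qed

end
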